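(* Let $\Omega\subset\mathbb{R}^d$ be a non-empty, bounded, open set, let $F$ be a probability density supported on $\Omega$, let $\epsilon>0$, and let $\Phi:\Omega\to\Omega$ be an $\epsilon$-deformation (in particular, a bijection of $\Omega$ onto itself). Let $F_\Phi(x)=F(\Phi(x))\,|\det(\nabla\Phi(x))|$ for $x\in\Omega$ and $F_\Phi=0$ elsewhere. Let $u_1,\dots,u_r$ be orthonormal vectors in $\mathbb{R}^d$, $\mathcal{U}=(u_1,\dots,u_r)$, and let $\mathcal{P}=\mathcal{P}_{\mathcal{U}}$ be the tomographic projection operator. Then for all $p\ge 1$, $$W_p(\mathcal{P}F,\mathcal{P}F_\Phi)\le \epsilon.$$
   Context: $|\cdot|$ is the Euclidean norm. An $\epsilon$-deformation $\Phi:\Omega\to\Omega$ is a $C^1$ bijection of $\Omega$ onto $\Omega$ with $\det(\nabla\Phi(x))\neq 0$ for all $x$ (where $\nabla \Phi$ is the Jacobian matrix) and $|x-\Phi(x)|\le\epsilon$ for all $x\in\Omega$. Tomographic projection: given $\mathcal{U}=(u_1,\dots,u_r)$ orthonormal, choose orthonormal vectors $u_{r+1},\dots,u_d$ orthogonal to $u_1,\dots,u_r$, and define $$(\mathcal{P}_{\mathcal{U}}F)(t_1,\dots,t_r)=\int_{\mathbb{R}^{d-r}}F(t_1u_1+\dots+t_ru_r+s_1u_{r+1}+\dots+s_{d-r}u_d)\,ds_1\cdots ds_{d-r}.$$ This is a function on $\mathbb{R}^r$. Wasserstein distance: for probability densities $f,g$ on a Euclidean space $\mathbb{R}^m$ (here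 $m=r$), $$W_p(f,g)=\min_{\Pi}\left(\iint|x-y|^p\,d\Pi(x,y)\right)^{1/p},$$ the minimum being over probability measures $\Pi$ on $\mathbb{R}^m\times\mathbb{R}^m$ with marginals having densities $f$ and $g$ respectively. *)

theory Defs
  imports "HOL-Analysis.Analysis" "HOL-Probability.Probability_Measure"
begin

definition orthonormal_family :: "'i set \<Rightarrow> ('i \<Rightarrow> 'a::real_inner) \<Rightarrow> bool" where
  "orthonormal_family I e \<longleftrightarrow> (\<forall>i\<in>I. \<forall>j\<in>I. e i \<bullet> e j = (if i = j then 1 else 0))"

(* Densities are Lebesgue (not only Borel) measurable functions. *)
definition prob_density :: "('a::euclidean_space \<Rightarrow> real) \<Rightarrow> bool" where
  "prob_density f \<longleftrightarrow> f \<in> borel_measurable lebesgue \<and> (\<forall>x. 0 \<le> f x) \<and>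
     (\<integral>\<^sup>+x. ennreal (f x) \<partial>lebesgue) = 1"

definition is_deformation ::
    "real \<Rightarrow> (real ^ 'd) set \<Rightarrow> (real ^ 'd \<Rightarrow> real ^ 'd) \<Rightarrow> bool" where
  "is_deformation \<epsilon> \<Omega> \<Phi> \<longleftrightarrow>
     bij_betw \<Phi> \<Omega> \<Omega> \<and>
     (\<forall>x\<in>\<Omega>. \<Phi> differentiable (at x)) \<and>
     continuous_on \<Omega> (\<lambda>x. jacobian \<Phi> (at x)) \<and>
     (\<forall>x\<in>\<Omega>. det (jacobian \<Phi> (at x)) \<noteq> 0) \<and>
     (\<forall>x\<in>\<Omega>. norm (x - \<Phi> x) \<le> \<epsilon>)"

definition deformed_density ::
    "(real ^ 'd) set \<Rightarrow> (real ^ 'd \<Rightarrow> real ^ 'd) \<Rightarrow> (real ^ 'd \<Rightarrow> real) \<Rightarrow> real ^ 'd \<Rightarrow> real" where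
  "deformed_density \<Omega> \<Phi> F x =
     (if x \<in> \<Omega> then F (\<Phi> x) * \<bar>det (jacobian \<Phi> (at x))\<bar> else 0)"

(* v 0, v 1, ... is an orthonormal basis of the orthogonal complement of the span of u.
   It is indexed by {..<d - r} rather than by a type, because d - r may be 0. *)
definition orthonormal_completion :: "('r::finite \<Rightarrow> real ^ 'd) \<Rightarrow> (nat \<Rightarrow> real ^ 'd) \<Rightarrow> bool" where
  "orthonormal_completion u v \<longleftrightarrow>
     orthonormal_family {..<CARD('d) - CARD('r)} v \<and>
     (\<forall>i. \<forall>j<CARD('d) - CARD('r). u i \<bullet> v j = 0)"

(* The completed product of d - r copies of lborel is Lebesgue measure on R^(d-r); for d = r it is
   the unit mass at the only point of R^0. The integral is 0 on sections that are not
   integrable; for a density these form a null set of values of t. *)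
definition tomographic_projection ::
    "('r::finite \<Rightarrow> real ^ 'd) \<Rightarrow> (nat \<Rightarrow> real ^ 'd) \<Rightarrow> (real ^ 'd \<Rightarrow> real) \<Rightarrow> real ^ 'r \<Rightarrow> real" where
  "tomographic_projection u v F t =
     (\<integral>s. F ((\<Sum>i\<in>UNIV. (t $ i) *\<^sub>R u i) + (\<Sum>j<CARD('d) - CARD('r). s j *\<^sub>R v j))
        \<partial>completion (Pi\<^sub>M {..<CARD('d) - CARD('r)} (\<lambda>_. lborel)))"

definition has_density :: "'a::euclidean_space measure \<Rightarrow> ('a \<Rightarrow> real) \<Rightarrow> bool" where
  "has_density \<mu> f \<longleftrightarrow> prob_density f \<and>
     (\<forall>A\<in>sets borel. emeasure \<mu> A = (\<integral>\<^sup>+x\<in>A. ennreal (f x) \<partial>lebesgue))"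

definition couplings ::
    "('a::euclidean_space \<Rightarrow> real) \<Rightarrow> ('a \<Rightarrow> real) \<Rightarrow> ('a \<times> 'a) measure set" where
  "couplings f g = {\<gamma>. prob_space \<gamma> \<and> sets \<gamma> = sets borel \<and>
     has_density (distr \<gamma> borel fst) f \<and> has_density (distr \<gamma> borel snd) g}"

definition ennreal_powr :: "ennreal \<Rightarrow> real \<Rightarrow> ennreal" where
  "ennreal_powr a q = (if a = \<infinity> then \<infinity> else ennreal (enn2real a powr q))"

(* The infimum over couplings is attained by the classical existence theorem for optimal
   couplings, so it is the minimum. It is \<infinity> if f or g is not a probability density. *)
definition wasserstein ::
    "real \<Rightarrow> ('a::euclidean_space \<Rightarrow> real) \<Rightarrow> ('a \<Rightarrow> real) \<Rightarrow> ennreal" where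
  "wasserstein p f g =
     (INF \<gamma>\<in>couplings f g.
        ennreal_powr (\<integral>\<^sup>+z. ennreal (norm (fst z - snd z) powr p) \<partial>\<gamma>) (1 / p))"

end

theory Submission
  imports Defs
begin

text \<open>
  The Wasserstein distance is bounded by exhibiting one coupling. Let \<open>X\<close> be a random point with
  density \<open>F\<^sub>\<Phi>\<close>. By the change of variables formula \<open>\<Phi>(X)\<close> has density \<open>F\<close>, and
  \<open>\<bar>\<Phi>(X) - X\<bar> \<le> \<epsilon>\<close> holds almost surely. Write \<open>\<pi>(x) = (x \<bullet> u\<^sub>i)\<^sub>i\<close> for the coordinates of the orthogonal
  projection to the span of \<open>u\<close>. The tomographic projection of a density is the density of the image
  law under \<open>\<pi>\<close>, so \<open>(\<pi>(\<Phi>(X)), \<pi>(X))\<close> is a coupling of the two projected densities. By Bessel's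
  inequality \<open>\<pi>\<close> does not increase distances, so the two components are never further apart than
  \<open>\<epsilon>\<close>, and the \<open>L\<^sup>p\<close> cost of the coupling is at most \<open>\<epsilon>\<close> for every \<open>p\<close>.

  Three facts carry the argument: the change of variables formula on \<open>\<real>\<^sup>d\<close>
  (\<open>nn_integral_change_of_variables\<close>), the fact that \<open>\<P>F\<close> is the marginal density of \<open>F\<close>
  (\<open>nn_integral_tomographic_projection\<close>), which is Fubini's theorem in the coordinates of the
  orthonormal frame \<open>(u, v)\<close>, and the contraction property \<open>norm_frame_coordinates_le\<close>.

  The change of variables formula and the invariance of Lebesgue measure under orthogonal maps are
  first stated for index types that carry a well-order. They extend to every finite index type,
  because any such type is in bijection with a well-ordered copy of itself and a relabelling of the
  coordinates preserves Lebesgue measure, inner products and Jacobian determinants.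
\<close>

section \<open>Measure preserving maps and completions\<close>

text \<open>Preimages of null sets under a measure preserving map are null sets, so measurability
  survives the completion of both sides.\<close>
lemma measurable_completion_measure_preserving:
  assumes T: "T \<in> measurable M N" and preserving: "distr M N T = N"
  shows "T \<in> measurable (completion M) (completion N)"
  using T preserving
  by (intro completion.measurable_completion2) (simp_all add: measurable_completion distr_completion)

lemma nn_integral_completion_measure_preserving:
  fixes f :: "'b \<Rightarrow> ennreal"
  assumes T: "T \<in> measurable M N" and preserving: "distr M N T = N"
    and f: "f \<in> borel_measurable (completion N)"
  shows "(\<integral>\<^sup>+x. f (T x) \<partial>completion M) = (\<integral>\<^sup>+y. f y \<partial>completion N)"
proof -
  obtain g where g: "g \<in> borel_measurable N" "AE y in N. f y = g y"
    using completion_ex_borel_measurable[OF f] by blast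
  have "AE y in distr M N T. f y = g y"
    unfolding preserving by (rule g(2))
  then have ae: "AE x in M. f (T x) = g (T x)"
    by (rule AE_distrD[OF T])
  have "(\<integral>\<^sup>+x. f (T x) \<partial>completion M) = (\<integral>\<^sup>+x. g (T x) \<partial>M)"
    unfolding nn_integral_completion by (rule nn_integral_cong_AE[OF ae])
  also have "\<dots> = (\<integral>\<^sup>+y. g y \<partial>distr M N T)"
    using T g(1) by (subst nn_integral_distr) auto
  also have "\<dots> = (\<integral>\<^sup>+y. f y \<partial>completion N)"
    unfolding nn_integral_completion preserving
    by (rule nn_integral_cong_AE) (use g(2) in auto)
  finally show ?thesis .
qed

lemma measurable_completion_cong_AE:
  assumes f: "f \<in> measurable M N" and ae: "AE x in M. f x = g x"
    and g: "\<And>x. x \<in> space M \<Longrightarrow> g x \<in> space N"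
  shows "g \<in> measurable (completion M) N"
proof (rule measurableI)
  fix A assume "A \<in> sets N"
  then have A: "f -` A \<inter> space M \<in> sets (completion M)"
    using measurable_sets[OF f] by auto
  have ae': "AE x in completion M. x \<in> f -` A \<inter> space M \<longleftrightarrow> x \<in> g -` A \<inter> space M"
    using AE_completion[OF ae] by eventually_elim auto
  show "g -` A \<inter> space (completion M) \<in> sets (completion M)"
    using completion.in_sets_AE[OF ae' A] by auto
qed (simp add: g)

section \<open>Relabelling the coordinates by a well-ordered index type\<close>

text \<open>A copy of a type whose order is that of the positions in an enumeration. It gives every finite
  type a twin in the classes \<^class>\<open>finite\<close> and \<^class>\<open>wellorder\<close>.\<close>
typedef 'n enumerated = "UNIV :: 'n set"
  morphisms index_of enumerate ..

instance enumerated :: (finite) finite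
proof
  have "inj (index_of :: 'a enumerated \<Rightarrow> 'a)"
    by (simp add: inj_def index_of_inject)
  then show "finite (UNIV :: 'a enumerated set)"
    by (rule finite_imageD[OF finite])
qed

instantiation enumerated :: (finite) wellorder
begin

definition less_eq_enumerated :: "'a enumerated \<Rightarrow> 'a enumerated \<Rightarrow> bool" where
  "less_eq_enumerated x y \<longleftrightarrow> to_nat (index_of x) \<le> to_nat (index_of y)"

definition less_enumerated :: "'a enumerated \<Rightarrow> 'a enumerated \<Rightarrow> bool" where
  "less_enumerated x y \<longleftrightarrow> to_nat (index_of x) < to_nat (index_of y)"

instance
proof
  fix x y z :: "'a enumerated" and P :: "'a enumerated \<Rightarrow> bool"
  show "x < y \<longleftrightarrow> x \<le> y \<and> \<not> y \<le> x" "x \<le> x" "x \<le> y \<or> y \<le> x"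
    by (auto simp: less_eq_enumerated_def less_enumerated_def)
  show "x \<le> z" if "x \<le> y" "y \<le> z"
    using that by (auto simp: less_eq_enumerated_def)
  show "x = y" if "x \<le> y" "y \<le> x"
    using that by (auto simp: less_eq_enumerated_def index_of_inject)
  show "P x" if step: "\<And>x. (\<And>y. y < x \<Longrightarrow> P y) \<Longrightarrow> P x"
  proof (induction "to_nat (index_of x)" arbitrary: x rule: less_induct)
    case less
    then show ?case
      by (metis step less_enumerated_def)
  qed
qed

end

lemma bij_enumerate: "bij (enumerate :: 'n \<Rightarrow> 'n enumerated)"
  by (rule o_bij[of index_of]) (simp_all add: fun_eq_iff index_of_inverse enumerate_inverse)

text \<open>Conjugation with the bijection maps the permutations of one index type to those of the other
  and preserves the sign, which matches the two Leibniz expansions term by term.\<close>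
lemma det_reindex:
  fixes A :: "'a::comm_ring_1 ^ 'm ^ 'm" and h :: "'n::finite \<Rightarrow> 'm::finite"
  assumes h: "bij h"
  shows "det (\<chi> i j. A $ h i $ h j) = det A"
proof -
  have h': "bij_betw (inv h) UNIV UNIV"
    using h by (rule bij_imp_bij_inv)
  have bij: "bij_betw (map_permutation UNIV h) {p. p permutes (UNIV::'n set)} {p. p permutes (UNIV::'m set)}"
  proof (rule bij_betw_byWitness[where f'="map_permutation UNIV (inv h)"])
    show "\<forall>p\<in>{p. p permutes (UNIV::'n set)}. map_permutation UNIV (inv h) (map_permutation UNIV h p) = p"
    proof safe
      show "map_permutation UNIV (inv h) (map_permutation UNIV h p) = p" if "p permutes UNIV" for p
        using map_permutation_compose_inv[OF h that] h by (simp add: inv_f_f bij_is_inj)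
    qed
    show "\<forall>p\<in>{p. p permutes (UNIV::'m set)}. map_permutation UNIV h (map_permutation UNIV (inv h) p) = p"
    proof safe
      show "map_permutation UNIV h (map_permutation UNIV (inv h) p) = p" if "p permutes UNIV" for p
        using map_permutation_compose_inv[OF h' that] h by (simp add: surj_f_inv_f bij_is_surj)
    qed
    show "map_permutation UNIV h ` {p. p permutes UNIV} \<subseteq> {p. p permutes UNIV}"
      using map_permutation_permutes[OF h] by auto
    show "map_permutation UNIV (inv h) ` {p. p permutes UNIV} \<subseteq> {p. p permutes UNIV}"
      using map_permutation_permutes[OF h'] by auto
  qed
  have "det A = (\<Sum>p | p permutes (UNIV::'n set). of_int (sign (map_permutation UNIV h p)) *
      (\<Prod>i\<in>UNIV. A $ i $ map_permutation UNIV h p i))"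
    unfolding det_def by (rule sum.reindex_bij_betw[OF bij, symmetric])
  also have "\<dots> = (\<Sum>p | p permutes (UNIV::'n set). of_int (sign p) * (\<Prod>i\<in>UNIV. A $ h i $ h (p i)))"
  proof (rule sum.cong[OF refl])
    fix p :: "'n \<Rightarrow> 'n" assume "p \<in> {p. p permutes UNIV}"
    then have "sign (map_permutation UNIV h p) = sign p"
      using h by (intro sign_map_permutation) (auto simp: bij_is_inj)
    moreover have "(\<Prod>i\<in>UNIV. A $ i $ map_permutation UNIV h p i)
        = (\<Prod>i\<in>UNIV. A $ h i $ map_permutation UNIV h p (h i))"
      by (rule prod.reindex_bij_betw[OF h, symmetric])
    ultimately show "of_int (sign (map_permutation UNIV h p)) * (\<Prod>i\<in>UNIV. A $ i $ map_permutation UNIV h p i)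
        = of_int (sign p) * (\<Prod>i\<in>UNIV. A $ h i $ h (p i))"
      using h by (simp add: map_permutation_apply bij_is_inj)
  qed
  finally show ?thesis
    by (simp add: det_def)
qed

definition relabel :: "('n \<Rightarrow> 'm) \<Rightarrow> real ^ 'm \<Rightarrow> real ^ 'n" where
  "relabel h x = (\<chi> i. x $ h i)"

lemma linear_relabel: "linear (relabel h)"
  by (simp add: linear_iff relabel_def vec_eq_iff)

lemma relabel_inv:
  assumes "bij h"
  shows "relabel h (relabel (inv h) x) = x" and "relabel (inv h) (relabel h y) = y"
  using assms by (simp_all add: relabel_def vec_eq_iff bij_inv_eq_iff inv_f_f bij_is_inj surj_f_inv_f bij_is_surj)

lemma borel_measurable_linear:
  fixes f :: "'a::euclidean_space \<Rightarrow> 'b::real_normed_vector"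
  assumes "linear f"
  shows "f \<in> borel_measurable borel"
  using assms by (intro borel_measurable_continuous_onI linear_continuous_on) (simp add: linear_linear)

lemma prod_Basis_cart:
  fixes f :: "real ^ 'n \<Rightarrow> 'b::comm_monoid_mult"
  shows "(\<Prod>b\<in>Basis. f b) = (\<Prod>i\<in>UNIV. f (axis i 1))"
proof -
  have B: "(Basis :: (real ^ 'n) set) = range (\<lambda>i. axis i 1)"
    by (auto simp: Basis_vec_def)
  have "inj (\<lambda>i::'n. axis i (1::real))"
    by (auto simp: inj_def axis_eq_axis)
  then show ?thesis
    unfolding B by (subst prod.reindex) auto
qed

text \<open>Boxes go to boxes with the same side lengths in another order.\<close>
lemma distr_lborel_relabel:
  fixes h :: "'n::finite \<Rightarrow> 'm::finite"
  assumes h: "bij h"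
  shows "distr lborel borel (relabel h) = lborel"
proof (rule lborel_eqI[symmetric])
  fix l u :: "real ^ 'n" assume le: "\<And>b. b \<in> Basis \<Longrightarrow> l \<bullet> b \<le> u \<bullet> b"
  have le': "l $ i \<le> u $ i" for i
    using le[of "axis i 1"] by (simp add: inner_axis)
  have "relabel h -` box l u = box (relabel (inv h) l) (relabel (inv h) u)"
    using h by (auto simp: mem_box_cart relabel_def)
      (metis bij_inv_eq_iff)+
  moreover have "emeasure lborel (box (relabel (inv h) l) (relabel (inv h) u)) =
      (\<Prod>b\<in>Basis. (relabel (inv h) u - relabel (inv h) l) \<bullet> b)"
    using le' by (subst emeasure_lborel_box) (auto simp: Basis_vec_def inner_axis relabel_def)
  moreover have "(\<Prod>b\<in>Basis. (relabel (inv h) u - relabel (inv h) l) \<bullet> b) = (\<Prod>b\<in>Basis. (u - l) \<bullet> b)"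
    unfolding prod_Basis_cart
    using prod.reindex_bij_betw[OF bij_imp_bij_inv[OF h], of "\<lambda>i. u $ i - l $ i"]
    by (simp add: inner_axis relabel_def)
  ultimately show "emeasure (distr lborel borel (relabel h)) (box l u) = (\<Prod>b\<in>Basis. (u - l) \<bullet> b)"
    by (simp add: emeasure_distr borel_measurable_linear linear_relabel)
qed simp

lemma distr_lborel_orthogonal_wellorder:
  fixes f :: "real ^ 'n::{finite,wellorder} \<Rightarrow> real ^ 'n::_"
  assumes f: "orthogonal_transformation f"
  shows "distr lborel borel f = lborel"
proof (rule lborel_eqI[symmetric])
  fix l u :: "real ^ 'n::_" assume le: "\<And>b. b \<in> Basis \<Longrightarrow> l \<bullet> b \<le> u \<bullet> b"
  have g: "orthogonal_transformation (inv f)"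
    using f by (rule orthogonal_transformation_inv)
  have pre: "f -` box l u = inv f ` box l u"
    using orthogonal_transformation_bij[OF f] by (simp add: bij_vimage_eq_inv_image)
  have meas: "inv f ` box l u \<in> lmeasurable"
    by (rule measurable_orthogonal_image[OF g]) simp
  have "f -` box l u \<in> sets borel"
    using measurable_sets_borel[OF borel_measurable_linear[OF orthogonal_transformation_linear[OF f]], of "box l u"]
    by simp
  then have "emeasure lborel (f -` box l u) = emeasure lebesgue (inv f ` box l u)"
    by (simp add: pre)
  also have "\<dots> = ennreal (measure lebesgue (inv f ` box l u))"
    using meas by (simp add: emeasure_eq_measure2)
  also have "\<dots> = ennreal (measure lebesgue (box l u))"
    by (subst measure_orthogonal_image[OF g]) auto
  also have "\<dots> = (\<Prod>b\<in>Basis. (u - l) \<bullet> b)"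
    using le by (simp add: measure_completion measure_lborel_box inner_diff_left)
  finally show "emeasure (distr lborel borel f) (box l u) = (\<Prod>b\<in>Basis. (u - l) \<bullet> b)"
    by (simp add: emeasure_distr borel_measurable_linear orthogonal_transformation_linear[OF f])
qed simp

text \<open>An orthogonal map conjugated with the relabelling isometry is an orthogonal map over the
  well-ordered index type.\<close>
lemma distr_lborel_orthogonal:
  fixes f :: "real ^ 'n \<Rightarrow> real ^ 'n"
  assumes f: "orthogonal_transformation f"
  shows "distr lborel borel f = lborel"
proof -
  let ?e = "enumerate :: 'n \<Rightarrow> 'n enumerated"
  let ?J = "relabel ?e" and ?K = "relabel (inv ?e)"
  define g where "g = ?K \<circ> f \<circ> ?J"
  note e = bij_enumerate
  have inner: "relabel (inv ?e) x \<bullet> relabel (inv ?e) y = x \<bullet> y" for x y :: "real ^ 'n"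
    using sum.reindex_bij_betw[OF bij_imp_bij_inv[OF e], of "\<lambda>i. x $ i * y $ i"]
    by (simp add: inner_vec_def relabel_def)
  have "linear g"
    unfolding g_def by (intro linear_compose linear_relabel orthogonal_transformation_linear[OF f])
  moreover have "g x \<bullet> g y = x \<bullet> y" for x y
    using f inner[of "?J x" "?J y"] by (simp add: g_def inner orthogonal_transformation_def relabel_inv[OF e])
  ultimately have g: "orthogonal_transformation g"
    by (simp add: orthogonal_transformation_def)
  have f_eq: "f = ?J \<circ> (g \<circ> ?K)"
    by (simp add: g_def fun_eq_iff relabel_inv[OF e])
  have meas[measurable]: "?J \<in> borel_measurable borel" "?K \<in> borel_measurable borel" "g \<in> borel_measurable borel"
    using \<open>linear g\<close> by (simp_all add: borel_measurable_linear linear_relabel)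
  have "distr lborel borel f = distr (distr (distr lborel borel ?K) borel g) borel ?J"
    unfolding f_eq by (simp add: distr_distr comp_assoc)
  also have "\<dots> = lborel"
    by (simp add: distr_lborel_relabel distr_lborel_orthogonal_wellorder[OF g] e bij_imp_bij_inv)
  finally show ?thesis .
qed

section \<open>Change of variables for nonnegative functions\<close>

text \<open>The change of variables theorem for vector-valued absolutely integrable functions, applied to
  \<open>real ^ 1\<close>: for nonnegative functions integrability and absolute integrability agree.\<close>
lemma has_integral_change_of_variables_nonneg:
  fixes f :: "real ^ 'n::{finite,wellorder} \<Rightarrow> real" and g :: "real ^ 'n::_ \<Rightarrow> real ^ 'n::_"
  assumes S: "S \<in> sets lebesgue"
    and der: "\<And>x. x \<in> S \<Longrightarrow> (g has_derivative g' x) (at x within S)"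
    and inj: "inj_on g S" and nonneg: "\<And>y. 0 \<le> f y"
  shows "((\<lambda>x. \<bar>det (matrix (g' x))\<bar> * f (g x)) has_integral b) S \<longleftrightarrow> (f has_integral b) (g ` S)"
proof -
  have *: "(h has_integral b) X \<longleftrightarrow>
      (\<lambda>x. vec (h x) :: real ^ 1) absolutely_integrable_on X \<and> integral X (\<lambda>x. vec (h x)) = (vec b :: real ^ 1)"
    if "\<And>x. 0 \<le> h x" for h :: "real ^ 'n::_ \<Rightarrow> real" and X
  proof -
    have "(\<lambda>x. vec (h x) :: real ^ 1) absolutely_integrable_on X \<longleftrightarrow> h integrable_on X"
      using absolutely_integrable_on_iff_nonneg[of X h] that
      unfolding absolutely_integrable_on_1_iff by simp
    moreover have "integral X (\<lambda>x. vec (h x)) = (vec b :: real ^ 1) \<longleftrightarrow> integral X h = b"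
      unfolding integral_on_1_eq by (simp add: vec_eq_iff)
    ultimately show ?thesis
      unfolding has_integral_iff by simp
  qed
  have vec: "(\<lambda>x. \<bar>det (matrix (g' x))\<bar> *\<^sub>R (vec (f (g x)) :: real ^ 1))
      = (\<lambda>x. vec (\<bar>det (matrix (g' x))\<bar> * f (g x)))"
    by (simp add: fun_eq_iff vec_eq_iff)
  have nonneg': "0 \<le> \<bar>det (matrix (g' x))\<bar> * f (g x)" for x
    by (simp add: nonneg)
  show ?thesis
    unfolding *[OF nonneg] *[OF nonneg'] vec[symmetric]
    by (rule has_absolute_integral_change_of_variables[OF S der inj])
qed

text \<open>For a nonnegative function the gauge integral over the whole space exists exactly if the
  function is Lebesgue measurable with finite integral. Measurability of the transformed function is
  therefore part of the conclusion, although a composition of a Lebesgue measurable function with a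
  differentiable one need not be measurable.\<close>
lemma nn_integral_change_of_variables_wellorder:
  fixes f :: "real ^ 'n::{finite,wellorder} \<Rightarrow> real" and g :: "real ^ 'n::_ \<Rightarrow> real ^ 'n::_"
  assumes S: "S \<in> sets lebesgue"
    and der: "\<And>x. x \<in> S \<Longrightarrow> (g has_derivative g' x) (at x within S)"
    and inj: "inj_on g S"
    and f: "f \<in> borel_measurable lebesgue" "\<And>y. 0 \<le> f y" "\<And>y. y \<notin> g ` S \<Longrightarrow> f y = 0"
    and finite: "(\<integral>\<^sup>+y. ennreal (f y) \<partial>lebesgue) < \<infinity>"
  defines "h \<equiv> \<lambda>x. if x \<in> S then f (g x) * \<bar>det (matrix (g' x))\<bar> else 0"
  shows "h \<in> borel_measurable lebesgue"
    and "(\<integral>\<^sup>+x. ennreal (h x) \<partial>lebesgue) = (\<integral>\<^sup>+y. ennreal (f y) \<partial>lebesgue)"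
proof -
  define b where "b = enn2real (\<integral>\<^sup>+y. ennreal (f y) \<partial>lebesgue)"
  have b: "(\<integral>\<^sup>+y. ennreal (f y) \<partial>lebesgue) = ennreal b" "0 \<le> b"
    using finite by (simp_all add: b_def)
  have "(f has_integral b) UNIV"
    using has_integral_iff_nn_integral_lebesgue[where f=f and r=b] f(1,2) b by simp
  moreover have "(\<lambda>y. if y \<in> g ` S then f y else 0) = f"
    using f(3) by (auto simp: fun_eq_iff)
  ultimately have "(f has_integral b) (g ` S)"
    using has_integral_restrict_UNIV[of "g ` S" f b] by simp
  then have "((\<lambda>x. \<bar>det (matrix (g' x))\<bar> * f (g x)) has_integral b) S"
    using has_integral_change_of_variables_nonneg[where f=f, OF S der inj] f(2) by blast
  then have "(h has_integral b) UNIV"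
    unfolding h_def by (subst has_integral_restrict_UNIV) (simp add: mult.commute)
  moreover have "0 \<le> h x" for x
    by (simp add: h_def f(2))
  ultimately have "h \<in> borel_measurable lebesgue \<and> (\<integral>\<^sup>+x. ennreal (h x) \<partial>lebesgue) = ennreal b"
    using has_integral_iff_nn_integral_lebesgue[where f=h and r=b] by simp
  then show "h \<in> borel_measurable lebesgue"
    and "(\<integral>\<^sup>+x. ennreal (h x) \<partial>lebesgue) = (\<integral>\<^sup>+y. ennreal (f y) \<partial>lebesgue)"
    using b by simp_all
qed

lemma det_matrix_relabel_conjugate:
  fixes f :: "real ^ 'n \<Rightarrow> real ^ 'n" and h :: "'n \<Rightarrow> 'm::finite"
  assumes h: "bij h"
  shows "det (matrix (relabel (inv h) \<circ> f \<circ> relabel h)) = det (matrix f)"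
proof -
  have "relabel h (axis j 1) = (axis (inv h j) 1 :: real ^ 'n)" for j
    using h by (auto simp: relabel_def axis_def vec_eq_iff bij_inv_eq_iff)
  then have "matrix (relabel (inv h) \<circ> f \<circ> relabel h) = (\<chi> i j. matrix f $ inv h i $ inv h j)"
    by (simp add: matrix_def vec_eq_iff) (simp add: relabel_def)
  then show ?thesis
    using det_reindex[OF bij_imp_bij_inv[OF h], of "matrix f"] by simp
qed

text \<open>The formula for an arbitrary finite index type, by transport along the relabelling.\<close>
lemma nn_integral_change_of_variables:
  fixes f :: "real ^ 'n \<Rightarrow> real" and g :: "real ^ 'n \<Rightarrow> real ^ 'n"
  assumes S: "S \<in> sets lebesgue"
    and der: "\<And>x. x \<in> S \<Longrightarrow> (g has_derivative g' x) (at x within S)"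
    and inj: "inj_on g S"
    and f: "f \<in> borel_measurable lebesgue" "\<And>y. 0 \<le> f y" "\<And>y. y \<notin> g ` S \<Longrightarrow> f y = 0"
    and finite: "(\<integral>\<^sup>+y. ennreal (f y) \<partial>lebesgue) < \<infinity>"
  defines "h \<equiv> \<lambda>x. if x \<in> S then f (g x) * \<bar>det (matrix (g' x))\<bar> else 0"
  shows "h \<in> borel_measurable lebesgue"
    and "(\<integral>\<^sup>+x. ennreal (h x) \<partial>lebesgue) = (\<integral>\<^sup>+y. ennreal (f y) \<partial>lebesgue)"
proof -
  let ?e = "enumerate :: 'n \<Rightarrow> 'n enumerated"
  let ?J = "relabel ?e" and ?K = "relabel (inv ?e)"
  note e = bij_enumerate[where 'n='n]
  have J: "?J \<in> measurable lborel lborel" "distr lborel lborel ?J = lborel"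
    using distr_lborel_relabel[OF e] borel_measurable_linear[OF linear_relabel[of ?e]]
    by (simp_all cong: distr_cong)
  have K: "?K \<in> measurable lborel lborel" "distr lborel lborel ?K = lborel"
    using distr_lborel_relabel[OF bij_imp_bij_inv[OF e]] borel_measurable_linear[OF linear_relabel[of "inv ?e"]]
    by (simp_all cong: distr_cong)
  note J' = measurable_completion_measure_preserving[OF J]
  note K' = measurable_completion_measure_preserving[OF K]
  define S0 where "S0 = ?J -` S"
  define g0 where "g0 = ?K \<circ> g \<circ> ?J"
  define g0' where "g0' x = ?K \<circ> g' (?J x) \<circ> ?J" for x
  define f0 where "f0 = f \<circ> ?J"
  define h0 where "h0 = (\<lambda>x. if x \<in> S0 then f0 (g0 x) * \<bar>det (matrix (g0' x))\<bar> else 0)"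
  have img: "?J ` S0 = S"
    unfolding S0_def by (rule surj_image_vimage_eq, rule surjI, rule relabel_inv(1)[OF e])
  have S0: "S0 \<in> sets lebesgue"
    using measurable_sets[OF J' S] by (simp add: S0_def)
  have der0: "(g0 has_derivative g0' x) (at x within S0)" if "x \<in> S0" for x
  proof -
    have "?J x \<in> S"
      using that by (simp add: S0_def)
    from der[OF this] have "(g has_derivative g' (?J x)) (at (?J x) within ?J ` S0)"
      by (simp add: img)
    moreover have "(?J has_derivative ?J) (at x within S0)"
      "(?K has_derivative ?K) (at (g (?J x)) within (g \<circ> ?J) ` S0)"
      by (simp_all add: linear_imp_has_derivative linear_relabel)
    ultimately show ?thesis
      unfolding g0_def g0'_def comp_assoc using diff_chain_within by (metis comp_apply)
  qed
  have inj0: "inj_on g0 S0"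
  proof (rule inj_onI)
    fix x y assume "x \<in> S0" "y \<in> S0" "g0 x = g0 y"
    then have "?J x \<in> S" "?J y \<in> S" "g (?J x) = g (?J y)"
      using relabel_inv(1)[OF e] by (simp_all add: S0_def g0_def) metis
    then have "?J x = ?J y"
      using inj by (simp add: inj_on_eq_iff)
    then show "x = y"
      by (metis relabel_inv(2)[OF e])
  qed
  have f0: "f0 \<in> borel_measurable lebesgue" "\<And>y. 0 \<le> f0 y"
    using f(2) measurable_comp[OF J' f(1)] by (simp_all add: f0_def)
  have zero: "f0 y = 0" if "y \<notin> g0 ` S0" for y
  proof (rule ccontr)
    assume "f0 y \<noteq> 0"
    then have "?J y \<in> g ` S"
      using f(3) by (auto simp: f0_def)
    then obtain x where x: "x \<in> S0" "?J y = g (?J x)"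
      using img by auto
    then have "y = g0 x"
      using relabel_inv(2)[OF e, of y] by (simp add: g0_def)
    with x that show False by auto
  qed
  have int0: "(\<integral>\<^sup>+y. ennreal (f0 y) \<partial>lebesgue) = (\<integral>\<^sup>+y. ennreal (f y) \<partial>lebesgue)"
    unfolding f0_def comp_def
    using nn_integral_completion_measure_preserving[OF J, of "\<lambda>y. ennreal (f y)"] f(1) by simp
  have h0: "h0 \<in> borel_measurable lebesgue"
    "(\<integral>\<^sup>+x. ennreal (h0 x) \<partial>lebesgue) = (\<integral>\<^sup>+y. ennreal (f0 y) \<partial>lebesgue)"
    unfolding h0_def
    using nn_integral_change_of_variables_wellorder[OF S0 der0 inj0 f0 zero] finite int0 by simp_all
  have h: "h = h0 \<circ> ?K"
    using det_matrix_relabel_conjugate[OF e]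
    by (auto simp: fun_eq_iff h_def h0_def S0_def g0_def g0'_def f0_def relabel_inv[OF e])
  show "h \<in> borel_measurable lebesgue"
    unfolding h using K' h0(1) by (rule measurable_comp)
  show "(\<integral>\<^sup>+x. ennreal (h x) \<partial>lebesgue) = (\<integral>\<^sup>+y. ennreal (f y) \<partial>lebesgue)"
    unfolding h comp_def int0[symmetric] h0(2)[symmetric]
    using nn_integral_completion_measure_preserving[OF K, of "\<lambda>y. ennreal (h0 y)"] h0(1) by simp
qed

section \<open>Lebesgue measure in the coordinates of an orthonormal frame\<close>

lemma borel_measurable_coordinate_combination:
  fixes a :: "'r::finite \<Rightarrow> 'a::euclidean_space" and b :: "nat \<Rightarrow> 'a"
  shows "(\<lambda>(t::real ^ 'r, s). (\<Sum>i\<in>UNIV. t $ i *\<^sub>R a i) + (\<Sum>j<k. s j *\<^sub>R b j))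
    \<in> borel_measurable (lborel \<Otimes>\<^sub>M Pi\<^sub>M {..<k} (\<lambda>_. lborel))"
proof -
  have [measurable]: "(\<lambda>t::real ^ 'r. t $ i) \<in> borel_measurable borel" for i
    by (intro borel_measurable_continuous_onI continuous_intros)
  have [measurable]: "(\<lambda>x. snd x j) \<in> borel_measurable ((lborel :: (real ^ 'r) measure) \<Otimes>\<^sub>M Pi\<^sub>M {..<k} (\<lambda>_. lborel :: real measure))"
    if "j \<in> {..<k}" for j
  proof -
    have "(\<lambda>x. snd x j) \<in> measurable ((lborel :: (real ^ 'r) measure) \<Otimes>\<^sub>M Pi\<^sub>M {..<k} (\<lambda>_. lborel :: real measure)) (lborel :: real measure)"
      by (rule measurable_compose[OF measurable_snd measurable_component_singleton[OF that]])
    then show ?thesis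
      by simp
  qed
  show ?thesis
    unfolding split_beta'
    by (intro borel_measurable_add borel_measurable_sum borel_measurable_scaleR) measurable
qed

text \<open>Splitting the standard coordinates into two groups turns Lebesgue measure into a product
  measure: the preimage of a box is a product of two boxes, whose volumes multiply to the volume of
  the given one.\<close>
lemma distr_product_coordinates:
  fixes e :: "'r::finite + nat \<Rightarrow> 'a::euclidean_space"
  assumes e: "bij_betw e (UNIV <+> {..<k}) Basis"
  shows "distr (lborel \<Otimes>\<^sub>M Pi\<^sub>M {..<k} (\<lambda>_. lborel)) borel
      (\<lambda>(t::real ^ 'r, s). (\<Sum>i\<in>UNIV. t $ i *\<^sub>R e (Inl i)) + (\<Sum>j<k. s j *\<^sub>R e (Inr j))) = lborel"
    (is "distr ?P borel ?T = _")
proof (rule lborel_eqI[symmetric])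
  fix l u :: 'a assume le: "\<And>b. b \<in> Basis \<Longrightarrow> l \<bullet> b \<le> u \<bullet> b"
  interpret product_sigma_finite "\<lambda>_::nat. lborel :: real measure" ..
  interpret P: finite_product_sigma_finite "\<lambda>_::nat. lborel :: real measure" "{..<k}"
    by standard simp
  have Inl_Basis: "e (Inl i) \<in> Basis" for i
    using e by (auto simp: bij_betw_def)
  have Inr_Basis: "e (Inr j) \<in> Basis" if "j < k" for j
    using e that by (auto simp: bij_betw_def)
  have inner: "e a \<bullet> e b = (if a = b then 1 else 0)" if "a \<in> UNIV <+> {..<k}" "b \<in> UNIV <+> {..<k}" for a b
  proof -
    have "e a \<in> Basis" "e b \<in> Basis" "e a = e b \<longleftrightarrow> a = b"
      using bij_betw_apply[OF e] inj_on_eq_iff[OF bij_betw_imp_inj_on[OF e]] that by blast+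
    then show ?thesis
      by (simp add: inner_Basis)
  qed
  have inner_Inl_Inl: "e (Inl i) \<bullet> e (Inl i') = (if i = i' then 1 else 0)" for i i'
    by (subst inner) auto
  have inner_Inl_Inr: "e (Inl i) \<bullet> e (Inr j) = 0" "e (Inr j) \<bullet> e (Inl i) = 0" if "j < k" for i j
    using that by (subst inner; auto)+
  have inner_Inr_Inr: "e (Inr j) \<bullet> e (Inr j') = (if j = j' then 1 else 0)" if "j < k" "j' < k" for j j'
    using that by (subst inner) auto
  have inner_Inl: "?T (t, s) \<bullet> e (Inl i) = t $ i" for t s i
    by (simp add: inner_Inl_Inl inner_Inl_Inr inner_add_left inner_sum_left if_distrib cong: if_cong)
  have inner_Inr: "?T (t, s) \<bullet> e (Inr j) = s j" if "j < k" for t s j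
    using that by (simp add: inner_Inr_Inr inner_Inl_Inr inner_add_left inner_sum_left if_distrib cong: if_cong sum.cong_simp)
  have ball: "(\<forall>b\<in>Basis. Q b) \<longleftrightarrow> (\<forall>i. Q (e (Inl i))) \<and> (\<forall>j<k. Q (e (Inr j)))" for Q
    unfolding bij_betw_imp_surj_on[OF e, symmetric] by auto
  define A where "A = box (\<chi> i. l \<bullet> e (Inl i)) (\<chi> i. u \<bullet> e (Inl i))"
  define B where "B = Pi\<^sub>E {..<k} (\<lambda>j. {l \<bullet> e (Inr j) <..< u \<bullet> e (Inr j)})"
  have A_iff: "t \<in> A \<longleftrightarrow> (\<forall>i. l \<bullet> e (Inl i) < t $ i \<and> t $ i < u \<bullet> e (Inl i))" for t
    by (simp add: A_def mem_box_cart)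
  have mem: "?T (t, s) \<in> box l u \<longleftrightarrow> t \<in> A \<and> (\<forall>j<k. s j \<in> {l \<bullet> e (Inr j) <..< u \<bullet> e (Inr j)})" for t s
    unfolding mem_box ball inner_Inl A_iff by (simp add: inner_Inr[simplified])
  have B_iff: "s \<in> B \<longleftrightarrow> s \<in> extensional {..<k} \<and> (\<forall>j<k. s j \<in> {l \<bullet> e (Inr j) <..< u \<bullet> e (Inr j)})" for s
    by (auto simp: B_def PiE_iff)
  have space: "(t, s) \<in> space ?P \<longleftrightarrow> s \<in> extensional {..<k}" for t s
    by (simp add: space_pair_measure space_PiM PiE_def)
  have "?T -` box l u \<inter> space ?P = A \<times> B"
  proof (intro set_eqI)
    fix z :: "(real ^ 'r) \<times> (nat \<Rightarrow> real)"
    obtain t s where z: "z = (t, s)"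
      by (cases z)
    show "z \<in> ?T -` box l u \<inter> space ?P \<longleftrightarrow> z \<in> A \<times> B"
      unfolding z Int_iff vimage_eq mem space mem_Times_iff fst_conv snd_conv B_iff by blast
  qed
  moreover have "emeasure lborel A = (\<Prod>i\<in>UNIV. (u - l) \<bullet> e (Inl i))"
  proof -
    have "(\<chi> i. l \<bullet> e (Inl i)) \<bullet> b \<le> (\<chi> i. u \<bullet> e (Inl i)) \<bullet> b" if "b \<in> Basis" for b :: "real ^ 'r"
      using that le[OF Inl_Basis] by (auto simp: Basis_vec_def inner_axis)
    then show ?thesis
      unfolding A_def by (simp add: emeasure_lborel_box prod_Basis_cart inner_axis inner_diff_left)
  qed
  moreover have "emeasure (Pi\<^sub>M {..<k} (\<lambda>_. lborel)) B = (\<Prod>j<k. (u - l) \<bullet> e (Inr j))"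
    unfolding B_def using le[OF Inr_Basis]
    by (subst emeasure_PiM) (auto simp: inner_diff_left intro!: prod_ennreal)
  moreover have "B \<in> sets (Pi\<^sub>M {..<k} (\<lambda>_. lborel))"
    unfolding B_def by (intro sets_PiM_I_finite) auto
  ultimately have "emeasure (distr ?P borel ?T) (box l u) =
      ennreal (\<Prod>i\<in>UNIV. (u - l) \<bullet> e (Inl i)) * ennreal (\<Prod>j<k. (u - l) \<bullet> e (Inr j))"
    by (subst emeasure_distr) (auto simp: P.emeasure_pair_measure_Times A_def borel_measurable_coordinate_combination)
  also have "\<dots> = ennreal (\<Prod>a\<in>UNIV <+> {..<k}. (u - l) \<bullet> e a)"
    using le[OF Inl_Basis] le[OF Inr_Basis]
    by (subst prod.Plus) (auto intro!: ennreal_mult[symmetric] prod_nonneg simp: inner_diff_left comp_def)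
  also have "(\<Prod>a\<in>UNIV <+> {..<k}. (u - l) \<bullet> e a) = (\<Prod>b\<in>Basis. (u - l) \<bullet> b)"
    by (rule prod.reindex_bij_betw[OF e])
  finally show "emeasure (distr ?P borel ?T) (box l u) = (\<Prod>b\<in>Basis. (u - l) \<bullet> b)" .
qed simp

lemma card_orthonormal_le:
  fixes u :: "'r::finite \<Rightarrow> real ^ 'd"
  assumes u: "orthonormal_family UNIV u"
  shows "CARD('r) \<le> CARD('d)"
proof -
  have uu: "u i \<bullet> u j = (if i = j then 1 else 0)" for i j
    using u by (simp add: orthonormal_family_def)
  have "inj u"
    by (rule injI) (metis uu zero_neq_one)
  have "0 \<notin> range u"
    by (metis inner_zero_left rangeE uu zero_neq_one)
  moreover have "pairwise orthogonal (range u)"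
    using uu by (auto simp: pairwise_def orthogonal_def split: if_split_asm)
  ultimately have "independent (range u)"
    by (intro pairwise_orthogonal_independent)
  then have "card (range u) \<le> DIM(real ^ 'd)"
    by (metis independent_bound)
  then show ?thesis
    using \<open>inj u\<close> by (simp add: card_image)
qed

text \<open>The point with coordinates \<open>(t, s)\<close> in the frame \<open>(u, v)\<close>; the fibre over \<open>t\<close> is the affine
  subspace over which the tomographic projection integrates.\<close>
definition frame_map :: "('r::finite \<Rightarrow> real ^ 'd) \<Rightarrow> (nat \<Rightarrow> real ^ 'd) \<Rightarrow> (real ^ 'r) \<times> (nat \<Rightarrow> real) \<Rightarrow> real ^ 'd" where
  "frame_map u v = (\<lambda>(t, s). (\<Sum>i\<in>UNIV. t $ i *\<^sub>R u i) + (\<Sum>j<CARD('d) - CARD('r). s j *\<^sub>R v j))"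

text \<open>Lebesgue measure on the coordinates along a fibre. The two type arguments are there only to
  determine the dimension.\<close>
abbreviation fibre_measure :: "'r::finite itself \<Rightarrow> 'd::finite itself \<Rightarrow> (nat \<Rightarrow> real) measure" where
  "fibre_measure r d \<equiv> Pi\<^sub>M {..<CARD('d) - CARD('r)} (\<lambda>_. lborel)"

lemma frame_map_measurable:
  fixes u :: "'r::finite \<Rightarrow> real ^ 'd"
  shows "frame_map u v \<in> measurable (lborel \<Otimes>\<^sub>M fibre_measure TYPE('r) TYPE('d)) lborel"
  using borel_measurable_coordinate_combination by (simp add: frame_map_def)

text \<open>The frame coordinates differ from standard coordinates by an orthogonal map: the one that
  takes a suitably indexed standard basis \<open>e\<close> to the frame \<open>w = (u, v)\<close>.\<close>
lemma distr_frame_map: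
  fixes u :: "'r::finite \<Rightarrow> real ^ 'd"
  assumes u: "orthonormal_family UNIV u" and v: "orthonormal_completion u v"
  shows "distr (lborel \<Otimes>\<^sub>M fibre_measure TYPE('r) TYPE('d)) lborel (frame_map u v) = lborel"
proof -
  let ?k = "CARD('d) - CARD('r)"
  let ?P = "lborel \<Otimes>\<^sub>M fibre_measure TYPE('r) TYPE('d) :: ((real ^ 'r) \<times> (nat \<Rightarrow> real)) measure"
  let ?I = "(UNIV :: 'r set) <+> {..<?k}"
  have "card ?I = card (Basis :: (real ^ 'd) set)"
    using card_orthonormal_le[OF u] by (simp add: card_Plus)
  then obtain e where e: "bij_betw e ?I (Basis :: (real ^ 'd) set)"
    using finite_same_card_bij[of ?I "Basis :: (real ^ 'd) set"] by auto
  have uu: "u i \<bullet> u j = (if i = j then 1 else 0)" for i j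
    using u by (simp add: orthonormal_family_def)
  have uv: "u i \<bullet> v j = 0" and vu: "v j \<bullet> u i = 0" if "j < ?k" for i j
    using v that by (simp_all add: orthonormal_completion_def inner_commute)
  have vv: "v i \<bullet> v j = (if i = j then 1 else 0)" if "i < ?k" "j < ?k" for i j
    using v that by (simp add: orthonormal_completion_def orthonormal_family_def)
  define w where "w = case_sum u v"
  have w: "w a \<bullet> w b = (if a = b then 1 else 0)" if "a \<in> ?I" "b \<in> ?I" for a b
    using that by (cases a; cases b) (auto simp: w_def uu vv uv vu)
  have ee: "e a \<bullet> e b = (if a = b then 1 else 0)" if "a \<in> ?I" "b \<in> ?I" for a b
  proof -
    have "e a \<in> Basis" "e b \<in> Basis" "e a = e b \<longleftrightarrow> a = b"
      using bij_betw_apply[OF e] inj_on_eq_iff[OF bij_betw_imp_inj_on[OF e]] that by blast+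
    then show ?thesis
      by (simp add: inner_Basis)
  qed
  define R where "R x = (\<Sum>a\<in>?I. (x \<bullet> e a) *\<^sub>R w a)" for x
  have R: "orthogonal_transformation R"
    unfolding orthogonal_transformation_def
  proof (intro conjI allI)
    show "linear R"
      by (rule linearI) (simp_all add: R_def inner_add_left scaleR_add_left sum.distrib scaleR_sum_right)
    fix x y
    have "R x \<bullet> R y = (\<Sum>a\<in>?I. (x \<bullet> e a) * (y \<bullet> e a))"
      by (simp add: R_def w inner_sum_left inner_sum_right if_distrib mult.commute cong: if_cong sum.cong_simp)
    also have "\<dots> = x \<bullet> y"
      unfolding euclidean_inner[of x y] by (rule sum.reindex_bij_betw[OF e])
    finally show "R x \<bullet> R y = x \<bullet> y" .
  qed
  define C where "C = (\<lambda>(t::real ^ 'r, s). (\<Sum>i\<in>UNIV. t $ i *\<^sub>R e (Inl i)) + (\<Sum>j<?k. s j *\<^sub>R e (Inr j)))"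
  have C: "C \<in> measurable ?P borel"
    unfolding C_def by (rule borel_measurable_coordinate_combination)
  have "frame_map u v = R \<circ> C"
  proof (rule ext, safe)
    fix t :: "real ^ 'r" and s :: "nat \<Rightarrow> real"
    have "C (t, s) = (\<Sum>b\<in>?I. case_sum (\<lambda>i. t $ i) s b *\<^sub>R e b)"
      by (simp add: C_def sum.Plus comp_def)
    then have "C (t, s) \<bullet> e a = case_sum (\<lambda>i. t $ i) s a" if "a \<in> ?I" for a
      using that by (simp add: ee inner_sum_left if_distrib cong: if_cong sum.cong_simp)
    then have "R (C (t, s)) = (\<Sum>a\<in>?I. case_sum (\<lambda>i. t $ i) s a *\<^sub>R w a)"
      unfolding R_def by (intro sum.cong) simp_all
    then show "frame_map u v (t, s) = (R \<circ> C) (t, s)"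
      by (simp add: frame_map_def w_def sum.Plus comp_def)
  qed
  moreover have "distr ?P borel (R \<circ> C) = distr (distr ?P borel C) borel R"
    using C borel_measurable_linear[OF orthogonal_transformation_linear[OF R]] by (simp add: distr_distr)
  moreover have "distr ?P borel C = lborel"
    unfolding C_def by (rule distr_product_coordinates[OF e])
  ultimately show ?thesis
    using distr_lborel_orthogonal[OF R] by (simp cong: distr_cong)
qed

definition frame_coordinates :: "('r::finite \<Rightarrow> real ^ 'd) \<Rightarrow> real ^ 'd \<Rightarrow> real ^ 'r" where
  "frame_coordinates u x = (\<chi> i. x \<bullet> u i)"

lemma linear_frame_coordinates: "linear (frame_coordinates u)"
  by (rule linearI) (simp_all add: frame_coordinates_def vec_eq_iff inner_add_left)

lemma frame_coordinates_frame_map: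
  fixes u :: "'r::finite \<Rightarrow> real ^ 'd"
  assumes u: "orthonormal_family UNIV u" and v: "orthonormal_completion u v"
  shows "frame_coordinates u (frame_map u v (t, s)) = t"
proof -
  have uu: "u i \<bullet> u j = (if i = j then 1 else 0)" for i j
    using u by (simp add: orthonormal_family_def)
  have vu: "v j \<bullet> u i = 0" if "j < CARD('d) - CARD('r)" for i j
    using v that by (simp add: orthonormal_completion_def inner_commute)
  show ?thesis
    by (simp add: uu vu frame_coordinates_def frame_map_def vec_eq_iff inner_add_left inner_sum_left
        if_distrib cong: if_cong)
qed

text \<open>Bessel's inequality. With \<open>y\<close> the orthogonal projection of \<open>x\<close> to the span of \<open>u\<close>, it is the
  nonnegativity of \<open>\<bar>x - y\<bar>\<^sup>2\<close>.\<close>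
lemma norm_frame_coordinates_le:
  assumes u: "orthonormal_family UNIV u"
  shows "norm (frame_coordinates u x) \<le> norm x"
proof -
  define y where "y = (\<Sum>i\<in>UNIV. (x \<bullet> u i) *\<^sub>R u i)"
  have uu: "u i \<bullet> u j = (if i = j then 1 else 0)" for i j
    using u by (simp add: orthonormal_family_def)
  have "y \<bullet> u i = x \<bullet> u i" for i
    by (simp add: uu y_def inner_sum_left if_distrib cong: if_cong)
  then have "y \<bullet> y = x \<bullet> y"
    by (simp add: y_def inner_sum_right)
  then have "0 \<le> x \<bullet> x - x \<bullet> y"
    using inner_ge_zero[of "x - y"] by (simp add: inner_diff_left inner_diff_right inner_commute)
  moreover have "x \<bullet> y = (\<Sum>i\<in>UNIV. (x \<bullet> u i) * (x \<bullet> u i))"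
    by (simp add: y_def inner_sum_right)
  moreover have "\<dots> = frame_coordinates u x \<bullet> frame_coordinates u x"
    by (simp add: frame_coordinates_def inner_vec_def)
  ultimately show ?thesis
    by (simp add: norm_le)
qed

section \<open>The tomographic projection is a marginal density\<close>

text \<open>This is Fubini's theorem in frame coordinates. As \<open>F\<close> is only Lebesgue measurable, it is replaced
  by a Borel function \<open>G\<close> that agrees with it almost everywhere, so that for almost all \<open>t\<close> the
  two agree almost everywhere on the fibre over \<open>t\<close>. The fibre integral \<open>q t\<close> of \<open>G\<close> takes values in
  the extended reals and is finite for almost all \<open>t\<close>, because its integral is \<open>1\<close>; at these \<open>t\<close> it
  is the Bochner integral that defines the projection.\<close>
lemma
  fixes u :: "'r::finite \<Rightarrow> real ^ 'd"
  assumes u: "orthonormal_family UNIV u" and v: "orthonormal_completion u v"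
    and F: "prob_density F"
  shows borel_measurable_tomographic_projection: "tomographic_projection u v F \<in> borel_measurable lebesgue"
    and nn_integral_tomographic_projection:
      "A \<in> sets borel \<Longrightarrow> (\<integral>\<^sup>+t\<in>A. ennreal (tomographic_projection u v F t) \<partial>lebesgue) =
        (\<integral>\<^sup>+x. ennreal (F x) * indicator A (frame_coordinates u x) \<partial>lebesgue)"
proof -
  let ?k = "CARD('d) - CARD('r)"
  let ?S = "fibre_measure TYPE('r) TYPE('d)"
  let ?T = "frame_map u v"
  interpret product_sigma_finite "\<lambda>_::nat. lborel :: real measure" ..
  interpret S: finite_product_sigma_finite "\<lambda>_::nat. lborel :: real measure" "{..<?k}"
    by standard simp
  interpret TS: pair_sigma_finite "lborel :: (real ^ 'r) measure" ?S ..
  have [measurable]: "?T \<in> borel_measurable (borel \<Otimes>\<^sub>M Pi\<^sub>M {..<?k} (\<lambda>_. borel))"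
    using frame_map_measurable[of u v]
    by (simp cong: measurable_cong_sets sets_pair_measure_cong sets_PiM_cong)
  have T[measurable]: "?T \<in> measurable (lborel \<Otimes>\<^sub>M ?S) lborel" and distr_T: "distr (lborel \<Otimes>\<^sub>M ?S) lborel ?T = lborel"
    using frame_map_measurable distr_frame_map[OF u v] by blast+
  have F_meas: "F \<in> borel_measurable lebesgue" and F_nonneg: "\<And>x. 0 \<le> F x"
    and F_int: "(\<integral>\<^sup>+x. ennreal (F x) \<partial>lebesgue) = 1"
    using F by (auto simp: prob_density_def)
  obtain G where G[measurable]: "G \<in> borel_measurable lborel" and FG: "AE x in lborel. F x = G x"
    using completion_ex_borel_measurable_real[OF F_meas] by blast
  define q where "q t = (\<integral>\<^sup>+s. ennreal (G (?T (t, s))) \<partial>?S)" for t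
  have q[measurable]: "q \<in> borel_measurable borel"
    unfolding q_def using S.borel_measurable_nn_integral[of "\<lambda>t s. ennreal (G (?T (t, s)))" lborel] by simp
  have q_int: "(\<integral>\<^sup>+t\<in>A. q t \<partial>lborel) = (\<integral>\<^sup>+x. ennreal (F x) * indicator A (frame_coordinates u x) \<partial>lebesgue)"
    if A[measurable]: "A \<in> sets borel" for A
  proof -
    have c[measurable]: "frame_coordinates u \<in> borel_measurable borel"
      by (rule borel_measurable_linear[OF linear_frame_coordinates])
    have "(\<integral>\<^sup>+t\<in>A. q t \<partial>lborel) = (\<integral>\<^sup>+t. \<integral>\<^sup>+s. ennreal (G (?T (t, s))) * indicator A t \<partial>?S \<partial>lborel)"
      unfolding q_def by (intro nn_integral_cong nn_integral_multc[symmetric]) measurable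
    also have "\<dots> = (\<integral>\<^sup>+t. \<integral>\<^sup>+s. ennreal (G (?T (t, s))) * indicator A (frame_coordinates u (?T (t, s))) \<partial>?S \<partial>lborel)"
      by (simp add: frame_coordinates_frame_map[OF u v])
    also have "\<dots> = (\<integral>\<^sup>+z. ennreal (G (?T z)) * indicator A (frame_coordinates u (?T z)) \<partial>(lborel \<Otimes>\<^sub>M ?S))"
      by (rule S.nn_integral_fst) measurable
    also have "\<dots> = (\<integral>\<^sup>+x. ennreal (G x) * indicator A (frame_coordinates u x) \<partial>distr (lborel \<Otimes>\<^sub>M ?S) lborel ?T)"
      by (subst nn_integral_distr) measurable
    also have "\<dots> = (\<integral>\<^sup>+x. ennreal (F x) * indicator A (frame_coordinates u x) \<partial>lebesgue)"
      unfolding distr_T nn_integral_completion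
      by (rule nn_integral_cong_AE) (use FG in auto)
    finally show ?thesis .
  qed
  have "(\<integral>\<^sup>+t. q t \<partial>lborel) = 1"
    using q_int[of UNIV] F_int by simp
  then have q_finite: "AE t in lborel. q t \<noteq> \<infinity>"
    by (intro nn_integral_PInf_AE) auto
  have "AE z in lborel \<Otimes>\<^sub>M ?S. F (?T z) = G (?T z)"
    by (rule AE_distrD[OF T]) (unfold distr_T, rule FG)
  then have sections: "AE t in lborel. AE s in ?S. F (?T (t, s)) = G (?T (t, s))"
    by (rule TS.AE_pair)
  have proj: "AE t in lborel. tomographic_projection u v F t = enn2real (q t)"
    using sections
  proof eventually_elim
    fix t assume ae: "AE s in ?S. F (?T (t, s)) = G (?T (t, s))"
    have "(\<lambda>s. G (?T (t, s))) \<in> borel_measurable ?S"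
      by measurable
    then have "(\<lambda>s. F (?T (t, s))) \<in> borel_measurable (completion ?S)"
      by (rule measurable_completion_cong_AE) (use ae in auto)
    then have "(\<integral>s. F (?T (t, s)) \<partial>completion ?S) = enn2real (\<integral>\<^sup>+s. ennreal (F (?T (t, s))) \<partial>completion ?S)"
      by (rule integral_eq_nn_integral) (simp add: F_nonneg)
    also have "(\<integral>\<^sup>+s. ennreal (F (?T (t, s))) \<partial>completion ?S) = q t"
      unfolding q_def nn_integral_completion by (rule nn_integral_cong_AE) (use ae in auto)
    finally show "tomographic_projection u v F t = enn2real (q t)"
      by (simp add: tomographic_projection_def frame_map_def)
  qed
  show "tomographic_projection u v F \<in> borel_measurable lebesgue"
    by (rule measurable_completion_cong_AE[of "\<lambda>t. enn2real (q t)"]) (use proj in auto)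
  show "(\<integral>\<^sup>+t\<in>A. ennreal (tomographic_projection u v F t) \<partial>lebesgue) =
      (\<integral>\<^sup>+x. ennreal (F x) * indicator A (frame_coordinates u x) \<partial>lebesgue)"
    if "A \<in> sets borel"
  proof -
    have "AE t in lborel. ennreal (tomographic_projection u v F t) = q t"
      using proj q_finite by eventually_elim (simp add: less_top)
    then have "(\<integral>\<^sup>+t\<in>A. ennreal (tomographic_projection u v F t) \<partial>lebesgue) = (\<integral>\<^sup>+t\<in>A. q t \<partial>lborel)"
      unfolding nn_integral_completion by (intro nn_integral_cong_AE) auto
    then show ?thesis
      using q_int[OF that] by simp
  qed
qed

lemma prob_density_tomographic_projection:
  fixes u :: "'r::finite \<Rightarrow> real ^ 'd"
  assumes u: "orthonormal_family UNIV u" and v: "orthonormal_completion u v"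
    and F: "prob_density F"
  shows "prob_density (tomographic_projection u v F)"
proof -
  have "(\<integral>\<^sup>+t. ennreal (tomographic_projection u v F t) \<partial>lebesgue) = (\<integral>\<^sup>+x. ennreal (F x) \<partial>lebesgue)"
    using nn_integral_tomographic_projection[OF assms, of UNIV] by simp
  moreover have "0 \<le> tomographic_projection u v F t" for t
    using F by (simp add: tomographic_projection_def prob_density_def)
  ultimately show ?thesis
    using borel_measurable_tomographic_projection[OF assms] F by (simp add: prob_density_def)
qed

text \<open>The form in which the marginal property is applied: a measure that is the image of the law with
  density \<open>F\<close> under the frame coordinates has density \<open>\<P>F\<close>.\<close>
lemma has_density_tomographic_projectionI:
  fixes u :: "'r::finite \<Rightarrow> real ^ 'd"
  assumes u: "orthonormal_family UNIV u" and v: "orthonormal_completion u v"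
    and F: "prob_density F"
    and law: "\<And>A. A \<in> sets borel \<Longrightarrow>
      emeasure \<mu> A = (\<integral>\<^sup>+x. ennreal (F x) * indicator A (frame_coordinates u x) \<partial>lebesgue)"
  shows "has_density \<mu> (tomographic_projection u v F)"
  unfolding has_density_def
  using prob_density_tomographic_projection[OF u v F] nn_integral_tomographic_projection[OF u v F] law
  by simp

section \<open>The deformed density\<close>

text \<open>If \<open>X\<close> has density \<open>F\<^sub>\<Phi>\<close>, then \<open>\<Phi>(X)\<close> has density \<open>F\<close>. This is the change of variables
  \<open>y = \<Phi>(x)\<close> in the integral of \<open>F\<close> over \<open>A\<close>.\<close>
lemma nn_integral_deformed_density:
  fixes F :: "real ^ 'd \<Rightarrow> real"
  assumes \<Omega>: "open \<Omega>" and F: "prob_density F" and zero: "\<And>x. x \<notin> \<Omega> \<Longrightarrow> F x = 0"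
    and \<Phi>: "is_deformation \<epsilon> \<Omega> \<Phi>"
    and A: "A \<in> sets borel"
  shows "deformed_density \<Omega> \<Phi> F \<in> borel_measurable lebesgue"
    and "(\<integral>\<^sup>+x. ennreal (deformed_density \<Omega> \<Phi> F x) * indicator A (\<Phi> x) \<partial>lebesgue) =
      (\<integral>\<^sup>+y. ennreal (F y) * indicator A y \<partial>lebesgue)"
proof -
  have S: "\<Omega> \<in> sets lebesgue"
    using \<Omega> by simp
  have bij: "bij_betw \<Phi> \<Omega> \<Omega>"
    using \<Phi> by (simp add: is_deformation_def)
  have der: "(\<Phi> has_derivative (\<lambda>h. jacobian \<Phi> (at x) *v h)) (at x within \<Omega>)" if "x \<in> \<Omega>" for x
  proof -
    have "\<Phi> differentiable (at x)"
      using \<Phi> that unfolding is_deformation_def by blast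
    then show ?thesis
      unfolding jacobian_works by (rule has_derivative_at_withinI)
  qed
  have F_meas: "F \<in> borel_measurable lebesgue" and F_nonneg: "\<And>x. 0 \<le> F x"
    and F_int: "(\<integral>\<^sup>+x. ennreal (F x) \<partial>lebesgue) = 1"
    using F by (auto simp: prob_density_def)
  have A': "A \<in> sets lebesgue"
    using A by simp
  \<comment> \<open>The whole space as \<open>B\<close> yields the measurability of \<open>F\<^sub>\<Phi>\<close>, the set \<open>A\<close> the integral formula.\<close>
  have cov: "(\<lambda>x. if x \<in> \<Omega> then F (\<Phi> x) * indicator B (\<Phi> x) * \<bar>det (jacobian \<Phi> (at x))\<bar> else 0)
        \<in> borel_measurable lebesgue"
      (is "?h \<in> _")
    "(\<integral>\<^sup>+x. ennreal (if x \<in> \<Omega> then F (\<Phi> x) * indicator B (\<Phi> x) * \<bar>det (jacobian \<Phi> (at x))\<bar> else 0) \<partial>lebesgue) =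
      (\<integral>\<^sup>+y. ennreal (F y * indicator B y) \<partial>lebesgue)"
    if B: "B \<in> sets lebesgue" for B
  proof -
    have meas: "(\<lambda>y. F y * indicator B y) \<in> borel_measurable lebesgue"
      using F_meas B by measurable
    have "(\<integral>\<^sup>+y. ennreal (F y * indicator B y) \<partial>lebesgue) \<le> (\<integral>\<^sup>+y. ennreal (F y) \<partial>lebesgue)"
      by (intro nn_integral_mono) (auto simp: F_nonneg split: split_indicator)
    also have "\<dots> < \<infinity>"
      using F_int by simp
    finally have finite: "(\<integral>\<^sup>+y. ennreal (F y * indicator B y) \<partial>lebesgue) < \<infinity>" .
    have nonneg: "0 \<le> F y * indicator B y" for y
      by (simp add: F_nonneg)
    have outside: "F y * indicator B y = 0" if "y \<notin> \<Phi> ` \<Omega>" for y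
      using that zero bij_betw_imp_surj_on[OF bij] by simp
    note cov = nn_integral_change_of_variables[where f="\<lambda>y. F y * indicator B y",
        OF S der bij_betw_imp_inj_on[OF bij] meas nonneg outside finite]
    show "?h \<in> borel_measurable lebesgue"
      using cov(1) unfolding matrix_of_matrix_vector_mul .
    show "(\<integral>\<^sup>+x. ennreal (?h x) \<partial>lebesgue) = (\<integral>\<^sup>+y. ennreal (F y * indicator B y) \<partial>lebesgue)"
      using cov(2) unfolding matrix_of_matrix_vector_mul .
  qed
  have "deformed_density \<Omega> \<Phi> F =
      (\<lambda>x. if x \<in> \<Omega> then F (\<Phi> x) * indicator UNIV (\<Phi> x) * \<bar>det (jacobian \<Phi> (at x))\<bar> else 0)"
    by (simp add: fun_eq_iff deformed_density_def)
  then show "deformed_density \<Omega> \<Phi> F \<in> borel_measurable lebesgue"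
    using cov(1)[of UNIV] by simp
  have "(\<integral>\<^sup>+x. ennreal (deformed_density \<Omega> \<Phi> F x) * indicator A (\<Phi> x) \<partial>lebesgue) =
      (\<integral>\<^sup>+x. ennreal (if x \<in> \<Omega> then F (\<Phi> x) * indicator A (\<Phi> x) * \<bar>det (jacobian \<Phi> (at x))\<bar> else 0) \<partial>lebesgue)"
    by (intro nn_integral_cong) (auto simp: deformed_density_def split: split_indicator)
  also have "\<dots> = (\<integral>\<^sup>+y. ennreal (F y * indicator A y) \<partial>lebesgue)"
    by (rule cov(2)[OF A'])
  also have "\<dots> = (\<integral>\<^sup>+y. ennreal (F y) * indicator A y \<partial>lebesgue)"
    by (intro nn_integral_cong) (auto split: split_indicator)
  finally show "(\<integral>\<^sup>+x. ennreal (deformed_density \<Omega> \<Phi> F x) * indicator A (\<Phi> x) \<partial>lebesgue) =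
      (\<integral>\<^sup>+y. ennreal (F y) * indicator A y \<partial>lebesgue)" .
qed

lemma prob_density_deformed_density:
  fixes F :: "real ^ 'd \<Rightarrow> real"
  assumes \<Omega>: "open \<Omega>" and F: "prob_density F" and zero: "\<And>x. x \<notin> \<Omega> \<Longrightarrow> F x = 0"
    and \<Phi>: "is_deformation \<epsilon> \<Omega> \<Phi>"
  shows "prob_density (deformed_density \<Omega> \<Phi> F)"
  using nn_integral_deformed_density[OF assms, of UNIV] F
  by (simp add: prob_density_def deformed_density_def)

section \<open>The coupling\<close>

lemma ennreal_powr_le:
  assumes "a \<le> ennreal (c powr p)" "0 < c" "0 < p"
  shows "ennreal_powr a (1 / p) \<le> ennreal c"
proof -
  have "a \<noteq> \<infinity>"
    using assms(1) by (auto simp: top_unique)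
  have "enn2real a \<le> c powr p"
    using assms(1) by (intro enn2real_leI) auto
  then have "enn2real a powr (1 / p) \<le> (c powr p) powr (1 / p)"
    using assms by (intro powr_mono2) auto
  also have "\<dots> = c"
    using assms by (simp add: powr_powr)
  finally show ?thesis
    using \<open>a \<noteq> \<infinity>\<close> by (simp add: ennreal_powr_def ennreal_leI)
qed

text \<open>On a probability space the \<open>L\<^sup>p\<close> norm is at most the essential supremum.\<close>
lemma wasserstein_le_of_coupling:
  assumes \<gamma>: "\<gamma> \<in> couplings f g" and close: "AE z in \<gamma>. norm (fst z - snd z) \<le> c"
    and "0 < c" and "1 \<le> p"
  shows "wasserstein p f g \<le> ennreal c"
proof -
  interpret prob_space \<gamma>
    using \<gamma> by (simp add: couplings_def)
  have "(\<integral>\<^sup>+z. ennreal (norm (fst z - snd z) powr p) \<partial>\<gamma>) \<le> (\<integral>\<^sup>+z. ennreal (c powr p) \<partial>\<gamma>)"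
    using close \<open>1 \<le> p\<close> by (intro nn_integral_mono_AE) (auto intro!: ennreal_leI powr_mono2)
  also have "\<dots> = ennreal (c powr p)"
    by (simp add: emeasure_space_1)
  finally have "ennreal_powr (\<integral>\<^sup>+z. ennreal (norm (fst z - snd z) powr p) \<partial>\<gamma>) (1 / p) \<le> ennreal c"
    using \<open>0 < c\<close> \<open>1 \<le> p\<close> by (intro ennreal_powr_le) auto
  with \<gamma> show ?thesis
    unfolding wasserstein_def by (rule INF_lower2)
qed

theorem theorem2p2:
  fixes \<Omega> :: "(real ^ 'd) set"
    and F :: "real ^ 'd \<Rightarrow> real"
    and \<Phi> :: "real ^ 'd \<Rightarrow> real ^ 'd"
    and u :: "'r::finite \<Rightarrow> real ^ 'd"
    and v :: "nat \<Rightarrow> real ^ 'd"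
    and \<epsilon> p :: real
  assumes "\<Omega> \<noteq> {}" and "bounded \<Omega>" and "open \<Omega>"
    and "prob_density F" and "\<And>x. x \<notin> \<Omega> \<Longrightarrow> F x = 0"
    and "\<epsilon> > 0" and "is_deformation \<epsilon> \<Omega> \<Phi>"
    and "orthonormal_family UNIV u" and "orthonormal_completion u v"
    and "p \<ge> 1"
  shows "wasserstein p (tomographic_projection u v F)
           (tomographic_projection u v (deformed_density \<Omega> \<Phi> F)) \<le> ennreal \<epsilon>"
proof -
  note \<Omega> = \<open>open \<Omega>\<close> and F = \<open>prob_density F\<close> and zero = assms(5) and \<Phi> = \<open>is_deformation \<epsilon> \<Omega> \<Phi>\<close>
    and u = \<open>orthonormal_family UNIV u\<close> and v = \<open>orthonormal_completion u v\<close>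
  define G where "G = deformed_density \<Omega> \<Phi> F"
  have G: "prob_density G"
    unfolding G_def by (rule prob_density_deformed_density[OF \<Omega> F zero \<Phi>])
  then have G_meas[measurable]: "G \<in> borel_measurable lebesgue" and G_int: "(\<integral>\<^sup>+x. ennreal (G x) \<partial>lebesgue) = 1"
    by (auto simp: prob_density_def)
  \<comment> \<open>\<open>F\<^sub>\<Phi>\<close> vanishes off \<open>\<Omega>\<close>, where \<open>\<Phi>\<close> is arbitrary and possibly not measurable; the identity is used
     there, which also keeps the displacement bound valid everywhere.\<close>
  define \<Psi> where "\<Psi> x = (if x \<in> \<Omega> then \<Phi> x else x)" for x
  let ?c = "frame_coordinates u"
  define \<gamma> where "\<gamma> = distr (density lebesgue (\<lambda>x. ennreal (G x))) borel (\<lambda>x. (?c (\<Psi> x), ?c x))"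
  have "continuous_on \<Omega> \<Phi>"
    using \<Phi> \<Omega> unfolding is_deformation_def
    by (intro continuous_at_imp_continuous_on) (auto intro: differentiable_imp_continuous_within)
  then have \<Psi>[measurable]: "\<Psi> \<in> borel_measurable borel"
    unfolding \<Psi>_def using \<Omega> by (intro borel_measurable_continuous_on_if) auto
  have c[measurable]: "?c \<in> borel_measurable borel"
    by (rule borel_measurable_linear[OF linear_frame_coordinates])
  have "(\<lambda>x. (?c (\<Psi> x), ?c x)) \<in> borel_measurable lborel"
    by measurable
  then have pair: "(\<lambda>x. (?c (\<Psi> x), ?c x)) \<in> borel_measurable (density lebesgue (\<lambda>x. ennreal (G x)))"
    by (simp add: measurable_completion)
  \<comment> \<open>To be used with the two projections \<open>fst\<close> and \<open>snd\<close>, which give the marginals.\<close>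
  have law: "emeasure (distr \<gamma> borel f) A =
      (\<integral>\<^sup>+x. ennreal (G x) * indicator A (f (?c (\<Psi> x), ?c x)) \<partial>lebesgue)"
    if f: "f \<in> borel_measurable borel" and A: "A \<in> sets borel" for f :: "(real ^ 'r) \<times> (real ^ 'r) \<Rightarrow> real ^ 'r" and A
  proof -
    have comp: "(\<lambda>x. f (?c (\<Psi> x), ?c x)) \<in> borel_measurable (density lebesgue (\<lambda>x. ennreal (G x)))"
      using measurable_compose[OF pair f] .
    have "emeasure (distr \<gamma> borel f) A =
        emeasure (distr (density lebesgue (\<lambda>x. ennreal (G x))) borel (\<lambda>x. f (?c (\<Psi> x), ?c x))) A"
      unfolding \<gamma>_def using f pair by (simp add: distr_distr comp_def)
    also have "\<dots> = emeasure (density lebesgue (\<lambda>x. ennreal (G x))) ((\<lambda>x. f (?c (\<Psi> x), ?c x)) -` A)"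
      using comp A by (subst emeasure_distr) auto
    also have "\<dots> = (\<integral>\<^sup>+x. ennreal (G x) * indicator ((\<lambda>x. f (?c (\<Psi> x), ?c x)) -` A) x \<partial>lebesgue)"
      using measurable_sets[OF comp A] by (subst emeasure_density) auto
    finally show ?thesis
      by (simp add: indicator_vimage comp_def)
  qed
  have "has_density (distr \<gamma> borel fst) (tomographic_projection u v F)"
  proof (rule has_density_tomographic_projectionI[OF u v F])
    fix A :: "(real ^ 'r) set" assume A: "A \<in> sets borel"
    have cA: "?c -` A \<in> sets borel"
      using measurable_sets_borel[OF c A] .
    have "emeasure (distr \<gamma> borel fst) A = (\<integral>\<^sup>+x. ennreal (G x) * indicator (?c -` A) (\<Phi> x) \<partial>lebesgue)"
      unfolding law[OF borel_measurable_continuous_onI[OF continuous_on_fst[OF continuous_on_id]] A]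
      by (intro nn_integral_cong) (auto simp: G_def deformed_density_def \<Psi>_def split: split_indicator)
    also have "\<dots> = (\<integral>\<^sup>+y. ennreal (F y) * indicator (?c -` A) y \<partial>lebesgue)"
      unfolding G_def by (rule nn_integral_deformed_density(2)[OF \<Omega> F zero \<Phi> cA])
    finally show "emeasure (distr \<gamma> borel fst) A = (\<integral>\<^sup>+y. ennreal (F y) * indicator A (?c y) \<partial>lebesgue)"
      by (simp add: indicator_vimage comp_def)
  qed
  moreover have "has_density (distr \<gamma> borel snd) (tomographic_projection u v G)"
    using law[OF borel_measurable_continuous_onI[OF continuous_on_snd[OF continuous_on_id]]]
    by (intro has_density_tomographic_projectionI[OF u v G]) simp
  moreover have "prob_space \<gamma>"
    unfolding \<gamma>_def using G_int G_meas pair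
    by (intro prob_space.prob_space_distr prob_spaceI) (simp_all add: emeasure_density)
  ultimately have coupling: "\<gamma> \<in> couplings (tomographic_projection u v F) (tomographic_projection u v G)"
    by (simp add: couplings_def \<gamma>_def)
  have close: "norm (?c (\<Psi> x) - ?c x) \<le> \<epsilon>" for x
  proof -
    have "norm (?c (\<Psi> x) - ?c x) \<le> norm (\<Psi> x - x)"
      using norm_frame_coordinates_le[OF u, of "\<Psi> x - x"] by (simp add: linear_diff[OF linear_frame_coordinates])
    also have "\<dots> \<le> \<epsilon>"
      using \<Phi> \<open>\<epsilon> > 0\<close> by (auto simp: \<Psi>_def is_deformation_def norm_minus_commute)
    finally show ?thesis .
  qed
  have "{z :: (real ^ 'r) \<times> (real ^ 'r). norm (fst z - snd z) \<le> \<epsilon>} \<in> sets borel"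
    by (intro borel_closed closed_Collect_le continuous_intros)
  then have "AE z in \<gamma>. norm (fst z - snd z) \<le> \<epsilon>"
    unfolding \<gamma>_def using pair by (subst AE_distr_iff) (auto simp: close)
  with coupling show ?thesis
    unfolding G_def using \<open>\<epsilon> > 0\<close> \<open>p \<ge> 1\<close> by (intro wasserstein_le_of_coupling)
qed

end
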